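(* Let $\Sigma$ be a finite alphabet with $|\Sigma|\ge 2$, and equip the set $\Sigma^{\mathbb{N}_0}$ of infinite words $\mathbf{a}=a_0a_1a_2\cdots$ over $\Sigma$ with the uniform Bernoulli product measure $\mathbb{P}$. Then $\mathbb{P}(\mathbf{Rdio}(\mathbf{a})=1)=1$.
   Context: The uniform Bernoulli product measure is the probability measure on $\Sigma^{\mathbb{N}_0}$ under which the letters $a_0,a_1,\dots$ are independent random variables, each uniformly distributed over $\Sigma$. For integers $0\le r\le s$, $\mathbf{a}[r,s]$ denotes the finite word $a_ra_{r+1}\cdots a_s$. $(\epsilon,\delta)$-closeness: for two finite words $U=u_1\cdots u_L$ and $V=v_1\cdots v_L$ of the same length $L>0$, a real $\epsilon>0$ and an integer $\delta\ge 0$, $U$ and $V$ are $(\epsilon,\delta)$-close if there exist $\delta$ (possibly empty) subintervals $I_1,\dots,I_\delta$ of $\{1,\dots,L\}$ such that $\{1\le i\le L: u_i\ne v_i\}\subseteq \bigcup_{j=1}^{\delta} I_j$ and $\left|\bigcup_{j=1}^{\delta} I_j\right|\le \epsilon L$. Refined Diophantine exponent: for a real $\rho\ge 1$, $\mathbf{a}$ satisfies Condition $( * )_\rho$ if for every $\epsilon>0$ there exist three sequences of integers $(r_n)_{n\ge0}$, $(s_n)_{n\ge0}$, $(t_n)_{n\ge0}$ and an integer $\delta\ge0$ such that: $-1\le r_n<s_n<t_n$ for all $n$; $t_n\ge\rho s_n$ for all $n$; $s_n-r_n\to\infty$ as $n\to\infty$; and for all $n$ large enough, $\mathbf{a}[r_n+1,r_n+t_n-s_n]$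 and $\mathbf{a}[s_n+1,t_n]$ are $(\epsilon,\delta)$-close. The refined Diophantine exponent $\mathbf{Rdio}(\mathbf{a})\in[1,\infty]$ is the supremum of the $\rho$ for which $\mathbf{a}$ satisfies $( * )_\rho$. *)

theory Defs
  imports "HOL-Probability.Probability"
begin

text \<open>
  Infinite words \<open>a\<^sub>0 a\<^sub>1 a\<^sub>2 \<dots>\<close> are functions on \<^typ>\<open>nat\<close>, finite words are lists.
\<close>

definition bernoulli_words :: "'a set \<Rightarrow> (nat \<Rightarrow> 'a) measure" where
  "bernoulli_words \<Sigma> = (\<Pi>\<^sub>M i\<in>(UNIV :: nat set). uniform_count_measure \<Sigma>)"

text \<open>
  The factor \<open>a[i, j]\<close>, both ends included. The indices are integers because the sequence \<open>r\<close>
  below may take the value \<open>-1\<close>; the definition is only used for \<open>0 \<le> i \<le> j\<close>.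
\<close>

definition factor :: "(nat \<Rightarrow> 'a) \<Rightarrow> int \<Rightarrow> int \<Rightarrow> 'a list" where
  "factor a i j = map (\<lambda>k. a (nat k)) [i..j]"

text \<open>
  Letters of a finite word are numbered from 1, hence the shift \<open>i - 1\<close> in the list access.
  A subinterval \<open>{p..q}\<close> is empty when \<open>q < p\<close>.
\<close>

definition subinterval :: "nat set \<Rightarrow> nat \<Rightarrow> bool" where
  "subinterval J L \<longleftrightarrow> (\<exists>p q. J = {p..q}) \<and> J \<subseteq> {1..L}"

definition eps_delta_close :: "real \<Rightarrow> nat \<Rightarrow> 'a list \<Rightarrow> 'a list \<Rightarrow> bool" where
  "eps_delta_close \<epsilon> \<delta> U V \<longleftrightarrow>
     length U = length V \<and> length U > 0 \<and>
     (\<exists>I :: nat \<Rightarrow> nat set.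
        (\<forall>j\<in>{1..\<delta>}. subinterval (I j) (length U)) \<and>
        {i \<in> {1..length U}. U ! (i - 1) \<noteq> V ! (i - 1)} \<subseteq> (\<Union>j\<in>{1..\<delta>}. I j) \<and>
        real (card (\<Union>j\<in>{1..\<delta>}. I j)) \<le> \<epsilon> * real (length U))"

definition condition_star :: "real \<Rightarrow> (nat \<Rightarrow> 'a) \<Rightarrow> bool" where
  "condition_star \<rho> a \<longleftrightarrow>
     (\<forall>\<epsilon>>0. \<exists>(r :: nat \<Rightarrow> int) (s :: nat \<Rightarrow> int) (t :: nat \<Rightarrow> int) (\<delta> :: nat).
        (\<forall>n. -1 \<le> r n \<and> r n < s n \<and> s n < t n) \<and>
        (\<forall>n. real_of_int (t n) \<ge> \<rho> * real_of_int (s n)) \<and>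
        filterlim (\<lambda>n. s n - r n) at_top sequentially \<and>
        (\<forall>\<^sub>F n in sequentially.
           eps_delta_close \<epsilon> \<delta> (factor a (r n + 1) (r n + t n - s n))
                               (factor a (s n + 1) (t n))))"

text \<open>
  Over a finite alphabet every word satisfies the condition for \<open>\<rho> = 1\<close>, because some letter
  occurs infinitely often; so the supremum is over a nonempty set and lies in \<open>[1, \<infinity>]\<close>.
\<close>

definition Rdio :: "(nat \<Rightarrow> 'a) \<Rightarrow> ereal" where
  "Rdio a = (SUP \<rho> \<in> {\<rho> :: real. \<rho> \<ge> 1 \<and> condition_star \<rho> a}. ereal \<rho>)"

end

theory Submission
  imports Defs "HOL-Real_Asymp.Real_Asymp"
begin

text \<open>
  Suppose \<open>\<rho> > 1\<close>. A mismatch set covered by \<open>\<delta>\<close> intervals of total length at most \<open>L / 2\<close> can be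
  chosen in at most \<open>(L + 1)^(2\<delta>)\<close> ways, and once the cover is fixed, the at least \<open>L / 2\<close>
  remaining coincidences have probability at most \<open>2^(-L / 2)\<close>. Since \<open>L = t - s\<close> and
  \<open>t \<ge> \<rho> s\<close>, only \<open>O(L\<^sup>2)\<close> pairs \<open>(r, s)\<close> matter for a given \<open>L\<close>, so the probabilities are summable
  and by the Borel--Cantelli lemma almost surely only finitely many \<open>L\<close> occur. As \<open>\<epsilon> = 1/2\<close> is
  fixed and \<open>\<delta>\<close> ranges over a countable set, almost surely condition \<open>(*)\<^sub>\<rho>\<close> fails.
\<close>

section \<open>Closeness of factors\<close>

text \<open>For nonempty words of equal length \<open>L\<close>, closeness depends only on the set
  \<open>D\<close> of positions where they differ. With \<open>D\<close> as a parameter, a random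
  pair of words can be treated by running over the finitely many values of \<open>D\<close>.\<close>

definition coverable :: "real \<Rightarrow> nat \<Rightarrow> nat \<Rightarrow> nat set \<Rightarrow> bool" where
  "coverable \<epsilon> \<delta> L D \<longleftrightarrow>
     (\<exists>I :: nat \<Rightarrow> nat set. (\<forall>j\<in>{1..\<delta>}. subinterval (I j) L) \<and>
        D \<subseteq> (\<Union>j\<in>{1..\<delta>}. I j) \<and> real (card (\<Union>j\<in>{1..\<delta>}. I j)) \<le> \<epsilon> * real L)"

definition mismatches :: "(nat \<Rightarrow> 'a) \<Rightarrow> int \<Rightarrow> int \<Rightarrow> nat \<Rightarrow> nat set" where
  "mismatches a r s L = {i \<in> {1..L}. a (nat (r + int i)) \<noteq> a (nat (s + int i))}"

lemma eps_delta_close_factor_iff: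
  assumes "s < t"
  shows "eps_delta_close \<epsilon> \<delta> (factor a (r + 1) (r + t - s)) (factor a (s + 1) t) \<longleftrightarrow>
           coverable \<epsilon> \<delta> (nat (t - s)) (mismatches a r s (nat (t - s)))"
proof -
  define L where "L = nat (t - s)"
  have L: "int L = t - s" "L > 0" using assms by (auto simp: L_def)
  have len: "length (factor a (r + 1) (r + t - s)) = L" "length (factor a (s + 1) t) = L"
    using L by (auto simp: factor_def)
  have "{i \<in> {1..L}. factor a (r + 1) (r + t - s) ! (i - 1) \<noteq> factor a (s + 1) t ! (i - 1)} =
        mismatches a r s L"
    unfolding mismatches_def
  proof (intro Collect_cong conj_cong refl)
    fix i assume i: "i \<in> {1..L}"
    have "factor a (r + 1) (r + t - s) ! (i - 1) = a (nat (r + int i))"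
      using i L by (auto simp: factor_def nth_upto of_nat_diff)
    moreover have "factor a (s + 1) t ! (i - 1) = a (nat (s + int i))"
      using i L by (auto simp: factor_def nth_upto of_nat_diff)
    ultimately show "(factor a (r + 1) (r + t - s) ! (i - 1) \<noteq> factor a (s + 1) t ! (i - 1)) =
        (a (nat (r + int i)) \<noteq> a (nat (s + int i)))" by simp
  qed
  then show ?thesis
    unfolding eps_delta_close_def coverable_def len L_def[symmetric] using L by simp
qed

lemma coverable_mono: "coverable \<epsilon> \<delta> L D \<Longrightarrow> \<epsilon> \<le> \<epsilon>' \<Longrightarrow> coverable \<epsilon>' \<delta> L D"
  unfolding coverable_def by (meson mult_right_mono of_nat_0_le_iff order_trans)

text \<open>A form of condition \<open>(*)\<^sub>\<rho>\<close> with countable quantifiers only, as measurability requires.\<close>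

lemma condition_star_iff:
  "condition_star \<rho> a \<longleftrightarrow>
     (\<forall>m. \<exists>\<delta>. \<forall>N. \<exists>r s t. -1 \<le> r \<and> r < s \<and> s < t \<and> \<rho> * real_of_int s \<le> real_of_int t \<and>
        int N \<le> s - r \<and> coverable (1 / real (Suc m)) \<delta> (nat (t - s)) (mismatches a r s (nat (t - s))))"
  (is "_ \<longleftrightarrow> ?R")
proof
  assume star: "condition_star \<rho> a"
  show ?R
  proof
    fix m
    have "1 / real (Suc m) > 0" by simp
    then obtain r s t :: "nat \<Rightarrow> int" and \<delta> where
      *: "\<forall>n. -1 \<le> r n \<and> r n < s n \<and> s n < t n" "\<forall>n. real_of_int (t n) \<ge> \<rho> * real_of_int (s n)"
        "filterlim (\<lambda>n. s n - r n) at_top sequentially"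
      and ev: "\<forall>\<^sub>F n in sequentially.
           eps_delta_close (1 / real (Suc m)) \<delta> (factor a (r n + 1) (r n + t n - s n))
                               (factor a (s n + 1) (t n))"
      using star unfolding condition_star_def by blast
    have "\<exists>r s t. -1 \<le> r \<and> r < s \<and> s < t \<and> \<rho> * real_of_int s \<le> real_of_int t \<and>
        int N \<le> s - r \<and> coverable (1 / real (Suc m)) \<delta> (nat (t - s)) (mismatches a r s (nat (t - s)))" for N
    proof -
      have "\<forall>\<^sub>F n in sequentially. int N \<le> s n - r n"
        using *(3) by (simp add: filterlim_at_top)
      from eventually_happens[OF eventually_conj[OF this ev]] obtain n where
        "int N \<le> s n - r n" "eps_delta_close (1 / real (Suc m)) \<delta>
            (factor a (r n + 1) (r n + t n - s n)) (factor a (s n + 1) (t n))"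
        by auto
      then show ?thesis using * eps_delta_close_factor_iff by blast
    qed
    then show "\<exists>\<delta>. \<forall>N. \<exists>r s t. -1 \<le> r \<and> r < s \<and> s < t \<and> \<rho> * real_of_int s \<le> real_of_int t \<and>
        int N \<le> s - r \<and> coverable (1 / real (Suc m)) \<delta> (nat (t - s)) (mismatches a r s (nat (t - s)))"
      by blast
  qed
next
  assume R: ?R
  show "condition_star \<rho> a"
    unfolding condition_star_def
  proof (intro allI impI)
    fix \<epsilon> :: real assume "\<epsilon> > 0"
    then obtain m where m: "1 / real (Suc m) < \<epsilon>"
      using nat_approx_posE by blast
    from R[rule_format, of m] obtain \<delta> where "\<forall>N. \<exists>r s t. -1 \<le> r \<and> r < s \<and> s < t \<and> \<rho> * real_of_int s \<le> real_of_int t \<and>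
        int N \<le> s - r \<and> coverable (1 / real (Suc m)) \<delta> (nat (t - s)) (mismatches a r s (nat (t - s)))"
      by blast
    \<comment> \<open>Indexing the chosen triples by \<open>N\<close> itself makes the gaps
      \<open>s N - r N\<close> diverge, and closeness then holds for every index rather than only
      eventually.\<close>
    then obtain r s t where
      *: "\<And>N. -1 \<le> r N \<and> r N < s N \<and> s N < t N \<and> \<rho> * real_of_int (s N) \<le> real_of_int (t N) \<and>
        int N \<le> s N - r N \<and> coverable (1 / real (Suc m)) \<delta> (nat (t N - s N)) (mismatches a (r N) (s N) (nat (t N - s N)))"
      by metis
    have "filterlim (\<lambda>n. s n - r n) at_top sequentially"
      using * by (intro filterlim_at_top_mono[OF filterlim_int_sequentially]) auto
    moreover have "eps_delta_close \<epsilon> \<delta> (factor a (r n + 1) (r n + t n - s n)) (factor a (s n + 1) (t n))" for n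
      using *[of n] m eps_delta_close_factor_iff coverable_mono less_imp_le by blast
    ultimately show "\<exists>r s t \<delta>. (\<forall>n. -1 \<le> r n \<and> r n < s n \<and> s n < t n) \<and>
        (\<forall>n. real_of_int (t n) \<ge> \<rho> * real_of_int (s n)) \<and>
        filterlim (\<lambda>n. s n - r n) at_top sequentially \<and>
        (\<forall>\<^sub>F n in sequentially.
           eps_delta_close \<epsilon> \<delta> (factor a (r n + 1) (r n + t n - s n)) (factor a (s n + 1) (t n)))"
      using * by (intro exI[of _ r] exI[of _ s] exI[of _ t] exI[of _ \<delta>]) auto
  qed
qed

section \<open>Dependence on the exponent, and the event that \<open>Rdio\<close> equals 1\<close>

text \<open>The same triples serve both exponents: \<open>-1 \<le> r < s\<close> forces
  \<open>s \<ge> 0\<close>, so lowering the factor in front of \<open>s\<close> only weakens the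
  bound on \<open>t\<close>.\<close>

lemma condition_star_antimono:
  assumes "condition_star \<rho> a" "\<rho>' \<le> \<rho>"
  shows "condition_star \<rho>' a"
proof -
  have "\<rho>' * real_of_int s \<le> real_of_int t" if "\<rho> * real_of_int s \<le> real_of_int t" "-1 \<le> r" "r < s" for r s t
    using that assms(2) mult_right_mono[of \<rho>' \<rho> "real_of_int s"] by auto
  then show ?thesis using assms(1) unfolding condition_star_iff by meson
qed

text \<open>By pigeonhole some letter occurs infinitely often. Two far apart occurrences are equal
  factors of length 1, so no covering interval is needed and \<open>\<delta> = 0\<close> works for
  every \<open>N\<close>.\<close>

lemma condition_star_1:
  assumes "finite \<Sigma>" "\<And>n. a n \<in> \<Sigma>"
  shows "condition_star 1 a"
proof -
  have "finite (range a)" using assms by (meson finite_subset image_subsetI)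
  then obtain x where x: "infinite {n. a n = x}"
    using inf_img_fin_domE[of a UNIV] by (auto simp: vimage_def)
  then obtain p where p: "a p = x" using not_finite_existsD by auto
  have "\<exists>r s t. -1 \<le> r \<and> r < s \<and> s < t \<and> 1 * real_of_int s \<le> real_of_int t \<and>
        int N \<le> s - r \<and> coverable (1 / real (Suc m)) 0 (nat (t - s)) (mismatches a r s (nat (t - s)))" for m N
  proof -
    obtain q where q: "q > p + N" "a q = x"
      using x by (auto simp: infinite_nat_iff_unbounded)
    have "mismatches a (int p - 1) (int q - 1) 1 = {}"
      using p q by (auto simp: mismatches_def)
    then have "coverable (1 / real (Suc m)) 0 1 (mismatches a (int p - 1) (int q - 1) 1)"
      by (auto simp: coverable_def)
    then show ?thesis using q
      \<comment> \<open>The factors begin at \<open>r + 1\<close> and \<open>s + 1\<close>, hence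
        the shift by one; \<open>p = 0\<close> gives the admissible value
        \<open>r = -1\<close>.\<close>
      by (intro exI[of _ "int p - 1"] exI[of _ "int q - 1"] exI[of _ "int q"]) auto
  qed
  then show ?thesis unfolding condition_star_iff by blast
qed

text \<open>Antimonotonicity reduces the supremum over a continuum of exponents to a sequence
  decreasing to 1. This makes the event a countable intersection, as needed both for measurability
  and for combining almost sure statements.\<close>

lemma Rdio_eq_1_iff:
  assumes "condition_star 1 a"
  shows "Rdio a = 1 \<longleftrightarrow> (\<forall>k. \<not> condition_star (1 + 1 / real (Suc k)) a)"
proof
  assume Rdio: "Rdio a = 1"
  show "\<forall>k. \<not> condition_star (1 + 1 / real (Suc k)) a"
  proof (intro allI notI)
    fix k assume "condition_star (1 + 1 / real (Suc k)) a"
    then have "ereal (1 + 1 / real (Suc k)) \<le> Rdio a"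
      unfolding Rdio_def by (intro SUP_upper) auto
    then show False by (simp add: Rdio one_ereal_def)
  qed
next
  assume *: "\<forall>k. \<not> condition_star (1 + 1 / real (Suc k)) a"
  have "\<rho> \<le> 1" if "condition_star \<rho> a" for \<rho>
  proof (rule ccontr)
    assume "\<not> \<rho> \<le> 1"
    then obtain k where "1 / real (Suc k) < \<rho> - 1"
      using nat_approx_posE[of "\<rho> - 1"] by auto
    then show False using that * condition_star_antimono[of \<rho> a "1 + 1 / real (Suc k)"] by auto
  qed
  then have "{\<rho>. \<rho> \<ge> 1 \<and> condition_star \<rho> a} = {1}" using assms by force
  then show "Rdio a = 1" unfolding Rdio_def by (simp add: one_ereal_def)
qed

section \<open>Counting covers by intervals\<close>

lemma card_subintervals_le: "card {J. subinterval J L} \<le> (L + 1)\<^sup>2"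
  and finite_subintervals: "finite {J. subinterval J L}"
proof -
  \<comment> \<open>Half-open intervals with endpoints in \<open>{..L}\<close> also represent the
    empty interval, as \<open>p = q = 0\<close>, so \<open>(L + 1)^2\<close> endpoint pairs
    suffice.\<close>
  have sub: "{J. subinterval J L} \<subseteq> (\<lambda>(p, q). {p<..q}) ` ({..L} \<times> {..L})"
  proof
    fix J assume "J \<in> {J. subinterval J L}"
    then obtain p q where J: "J = {p..q}" "J \<subseteq> {1..L}" unfolding subinterval_def by blast
    show "J \<in> (\<lambda>(p, q). {p<..q}) ` ({..L} \<times> {..L})"
    proof (cases "p \<le> q")
      case True
      then have "1 \<le> p" "q \<le> L" using J by auto
      then show ?thesis using J True by (intro image_eqI[of _ _ "(p - 1, q)"]) auto
    next
      case False
      then show ?thesis using J by (intro image_eqI[of _ _ "(0, 0)"]) auto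
    qed
  qed
  show "finite {J. subinterval J L}" by (rule finite_subset[OF sub]) auto
  have "card {J. subinterval J L} \<le> card ((\<lambda>(p, q). {p<..q::nat}) ` ({..L} \<times> {..L}))"
    by (rule card_mono[OF _ sub]) auto
  also have "\<dots> \<le> card ({..L} \<times> {..L})" by (rule card_image_le) auto
  finally show "card {J. subinterval J L} \<le> (L + 1)\<^sup>2" by (simp add: power2_eq_square)
qed

text \<open>Candidate unions for tolerance 1/2, with the size bound stated in integers. Extensional
  families are used because there are only finitely many of them.\<close>

definition covers :: "nat \<Rightarrow> nat \<Rightarrow> nat set set" where
  "covers \<delta> L = {C \<in> (\<lambda>I. \<Union>j\<in>{1..\<delta>}. I j) ` ({1..\<delta>} \<rightarrow>\<^sub>E {J. subinterval J L}). 2 * card C \<le> L}"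

lemma finite_covers: "finite (covers \<delta> L)"
  unfolding covers_def by (intro finite_Collect_conjI disjI1) (simp add: finite_PiE finite_subintervals)

lemma card_covers_le: "card (covers \<delta> L) \<le> (L + 1) ^ (2 * \<delta>)"
proof -
  have fin: "finite ({1..\<delta>} \<rightarrow>\<^sub>E {J. subinterval J L})" by (auto intro!: finite_PiE finite_subintervals)
  have "card (covers \<delta> L) \<le> card ((\<lambda>I. \<Union>j\<in>{1..\<delta>}. I j) ` ({1..\<delta>} \<rightarrow>\<^sub>E {J. subinterval J L}))"
    unfolding covers_def using fin by (intro card_mono) auto
  also have "\<dots> \<le> card ({1..\<delta>} \<rightarrow>\<^sub>E {J. subinterval J L})"
    by (rule card_image_le[OF fin])
  also have "\<dots> = card {J. subinterval J L} ^ \<delta>" by (simp add: card_PiE)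
  also have "\<dots> \<le> ((L + 1)\<^sup>2) ^ \<delta>" by (intro power_mono card_subintervals_le) auto
  finally show ?thesis by (simp only: power_mult)
qed

lemma covers_subset: "C \<in> covers \<delta> L \<Longrightarrow> C \<subseteq> {1..L}"
  unfolding covers_def by (fastforce simp: subinterval_def PiE_iff)

lemma coverable_half_iff: "coverable (1 / 2) \<delta> L D \<longleftrightarrow> (\<exists>C\<in>covers \<delta> L. D \<subseteq> C)"
proof
  assume "coverable (1 / 2) \<delta> L D"
  then obtain I where I: "\<forall>j\<in>{1..\<delta>}. subinterval (I j) L" "D \<subseteq> (\<Union>j\<in>{1..\<delta>}. I j)"
    "real (card (\<Union>j\<in>{1..\<delta>}. I j)) \<le> 1 / 2 * real L" unfolding coverable_def by blast
  have eq: "(\<Union>j\<in>{1..\<delta>}. restrict I {1..\<delta>} j) = (\<Union>j\<in>{1..\<delta>}. I j)" by auto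
  have "(\<Union>j\<in>{1..\<delta>}. I j) \<in> (\<lambda>I. \<Union>j\<in>{1..\<delta>}. I j) ` ({1..\<delta>} \<rightarrow>\<^sub>E {J. subinterval J L})"
    using I(1) by (intro image_eqI[where x = "restrict I {1..\<delta>}"]) (auto simp: eq)
  then have "(\<Union>j\<in>{1..\<delta>}. I j) \<in> covers \<delta> L"
    using I(3) unfolding covers_def by auto
  then show "\<exists>C\<in>covers \<delta> L. D \<subseteq> C" using I(2) by blast
next
  assume "\<exists>C\<in>covers \<delta> L. D \<subseteq> C"
  then obtain I where I: "I \<in> {1..\<delta>} \<rightarrow>\<^sub>E {J. subinterval J L}" "2 * card (\<Union>j\<in>{1..\<delta>}. I j) \<le> L"
    "D \<subseteq> (\<Union>j\<in>{1..\<delta>}. I j)" unfolding covers_def by blast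
  then show "coverable (1 / 2) \<delta> L D"
    unfolding coverable_def by (intro exI[of _ I]) (auto simp: PiE_iff)
qed

section \<open>Coincidences in a random word\<close>

lemma card_coinciding_words_le:
  fixes g h :: "'i \<Rightarrow> nat"
  assumes "finite \<Sigma>" "inj_on h A" "\<And>i. i \<in> A \<Longrightarrow> g i < h i" "\<And>i. i \<in> A \<Longrightarrow> h i < n"
  shows "card {w \<in> {..<n} \<rightarrow>\<^sub>E \<Sigma>. \<forall>i\<in>A. w (g i) = w (h i)} \<le> card \<Sigma> ^ (n - card A)"
    (is "card ?W \<le> _")
proof -
  have sub: "h ` A \<subseteq> {..<n}" using assms(4) by auto
  define F where "F = {..<n} - h ` A"
  have "card F = n - card A"
    unfolding F_def using sub assms(2) by (subst card_Diff_subset) (auto simp: finite_subset card_image)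
  moreover have "card ?W \<le> card (F \<rightarrow>\<^sub>E \<Sigma>)"
  proof (rule card_inj_on_le[of "\<lambda>w. restrict w F"])
    show "inj_on (\<lambda>w. restrict w F) ?W"
    proof (rule inj_onI)
      fix w v assume w: "w \<in> ?W" and v: "v \<in> ?W" and eq: "restrict w F = restrict v F"
      have "w k = v k" if "k < n" for k
        using that
      proof (induction k rule: less_induct)
        case (less k)
        show ?case
        proof (cases "k \<in> h ` A")
          case True
          then obtain i where i: "i \<in> A" "k = h i" by auto
          then have "w (g i) = v (g i)" using less assms(3)[of i] by auto
          then show ?thesis using i w v by auto
        next
          case False
          then have "k \<in> F" using less by (auto simp: F_def)
          then show ?thesis using eq by (metis restrict_apply')
        qed
      qed
      then show "w = v" using w v by (intro PiE_ext[of w "{..<n}" "\<lambda>_. \<Sigma>"]) auto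
    qed
    show "(\<lambda>w. restrict w F) ` ?W \<subseteq> F \<rightarrow>\<^sub>E \<Sigma>" by (auto simp: F_def)
    show "finite (F \<rightarrow>\<^sub>E \<Sigma>)" using assms(1) by (auto simp: F_def intro!: finite_PiE)
  qed
  ultimately show ?thesis by (simp add: card_PiE F_def)
qed

section \<open>The Bernoulli measure: measurability and probability bounds\<close>

locale uniform_alphabet =
  fixes \<Sigma> :: "'a set"
  assumes finite_alphabet: "finite \<Sigma>" and card_alphabet: "card \<Sigma> \<ge> 2"
begin

lemma nonempty_alphabet: "\<Sigma> \<noteq> {}"
  using card_alphabet by auto

sublocale product_prob_space "\<lambda>_. uniform_count_measure \<Sigma>" "UNIV :: nat set"
proof -
  have "prob_space (uniform_count_measure \<Sigma>)"
    using finite_alphabet nonempty_alphabet by (rule prob_space_uniform_count_measure)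
  then show "product_prob_space (\<lambda>_. uniform_count_measure \<Sigma>)"
    by (intro product_prob_spaceI)
qed

abbreviation words :: "(nat \<Rightarrow> 'a) measure" where
  "words \<equiv> bernoulli_words \<Sigma>"

sublocale words: prob_space words
  unfolding bernoulli_words_def by (rule P.prob_space_axioms)

lemma space_words: "space words = {a. \<forall>n. a n \<in> \<Sigma>}"
  by (auto simp: bernoulli_words_def space_PiM space_uniform_count_measure PiE_iff)

lemma measurable_letter [measurable]: "(\<lambda>a. a n) \<in> measurable words (count_space \<Sigma>)"
proof -
  have "(\<lambda>a. a n) \<in> measurable words (uniform_count_measure \<Sigma>)"
    unfolding bernoulli_words_def by (rule measurable_component_singleton) simp
  then show ?thesis
    by (simp only: measurable_cong_sets[OF refl sets_uniform_count_measure_count_space])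
qed

text \<open>On the space all letters lie in the finite set \<open>\<Sigma>\<close>, so equality of
  two letters is a finite disjunction over their common value.\<close>

lemma measurable_letter_eq [measurable]: "Measurable.pred words (\<lambda>a. a m = a n)"
proof -
  have "Measurable.pred words (\<lambda>a. \<exists>x\<in>\<Sigma>. a m = x \<and> a n = x)"
    using countable_finite[OF finite_alphabet] by measurable
  then show ?thesis
    by (rule measurable_cong[THEN iffD1, rotated]) (auto simp: space_words)
qed

text \<open>The mismatch set takes finitely many values \<open>D\<close>. Whether \<open>D\<close>
  is coverable does not depend on the word, and having mismatch set \<open>D\<close> is a finite
  Boolean combination of letter equalities.\<close>

lemma measurable_coverable [measurable]:
  "Measurable.pred words (\<lambda>a. coverable \<epsilon> \<delta> L (mismatches a r s L))"
proof -
  have "(\<lambda>a :: nat \<Rightarrow> 'a. coverable \<epsilon> \<delta> L (mismatches a r s L)) =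
    (\<lambda>a. \<exists>D\<in>Pow {1..L}. coverable \<epsilon> \<delta> L D \<and>
      (\<forall>i\<in>{1..L}. i \<in> D \<longleftrightarrow> \<not> a (nat (r + int i)) = a (nat (s + int i))))"
    (is "_ = (\<lambda>a. \<exists>D\<in>_. ?Q a D)")
  proof
    fix a :: "nat \<Rightarrow> 'a"
    have "D = mismatches a r s L"
      if "D \<subseteq> {1..L}" "\<forall>i\<in>{1..L}. i \<in> D \<longleftrightarrow> \<not> a (nat (r + int i)) = a (nat (s + int i))" for D
      using that unfolding mismatches_def by blast
    moreover have "mismatches a r s L \<subseteq> {1..L}" by (auto simp: mismatches_def)
    moreover have "\<forall>i\<in>{1..L}. i \<in> mismatches a r s L \<longleftrightarrow> \<not> a (nat (r + int i)) = a (nat (s + int i))"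
      by (auto simp: mismatches_def)
    ultimately show "coverable \<epsilon> \<delta> L (mismatches a r s L) \<longleftrightarrow> (\<exists>D\<in>Pow {1..L}. ?Q a D)"
      by (metis PowD PowI)
  qed
  also have "Measurable.pred words \<dots>"
    by (intro pred_intros_finite(4) pred_intros_logic(3,4)) (simp, measurable)
  finally show ?thesis .
qed

lemma measurable_condition_star [measurable]: "Measurable.pred words (condition_star \<rho>)"
  unfolding condition_star_iff[abs_def] by measurable

text \<open>The event is covered by cylinders over the coinciding words of length \<open>n\<close>.
  Each has mass \<open>card \<Sigma>\<close> to the power \<open>-n\<close>, and there are at most
  \<open>card \<Sigma> ^ (n - card A)\<close> of them. Counting avoids any independence claim for
  the coincidences, whose positions may overlap.\<close>

lemma prob_coincidences_le:
  fixes g h :: "'i \<Rightarrow> nat"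
  assumes "finite A" "inj_on h A" "\<And>i. i \<in> A \<Longrightarrow> g i < h i"
  shows "words.prob {a \<in> space words. \<forall>i\<in>A. a (g i) = a (h i)} \<le> (1 / real (card \<Sigma>)) ^ card A"
proof -
  obtain n where n: "\<And>i. i \<in> A \<Longrightarrow> h i < n"
    using finite_nat_set_iff_bounded[of "h ` A"] assms(1) by auto
  have "h ` A \<subseteq> {..<n}" using n by auto
  then have An: "card A \<le> n"
    using assms(2) by (metis card_image card_lessThan card_mono finite_lessThan)
  define W where "W = {w \<in> {..<n} \<rightarrow>\<^sub>E \<Sigma>. \<forall>i\<in>A. w (g i) = w (h i)}"
  define cyl where "cyl w = {a \<in> space words. \<forall>k\<in>{..<n}. a k \<in> {w k}}" for w
  have finW: "finite W" unfolding W_def using finite_alphabet by (auto intro!: finite_PiE)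
  have prob_cyl: "words.prob (cyl w) = (1 / real (card \<Sigma>)) ^ n" if "w \<in> W" for w
  proof -
    have w: "\<And>k. k < n \<Longrightarrow> w k \<in> \<Sigma>" using that by (auto simp: W_def PiE_iff)
    have "emeasure words (cyl w) = (\<Prod>k<n. emeasure (uniform_count_measure \<Sigma>) {w k})"
      unfolding cyl_def bernoulli_words_def
      by (rule emeasure_PiM_Collect) (auto simp: sets_uniform_count_measure w)
    also have "\<dots> = (\<Prod>k<n. ennreal (1 / real (card \<Sigma>)))"
      by (intro prod.cong refl) (simp add: emeasure_uniform_count_measure finite_alphabet w)
    also have "\<dots> = ennreal ((1 / real (card \<Sigma>)) ^ n)"
      by (simp add: ennreal_power)
    finally show ?thesis by (simp add: measure_def)
  qed
  have cyl_sets: "cyl w \<in> words.events" if "w \<in> W" for w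
  proof -
    have "Measurable.pred words (\<lambda>a. \<forall>k\<in>{..<n}. a k = w k)" by measurable
    then show ?thesis by (simp add: cyl_def pred_def)
  qed
  have "{a \<in> space words. \<forall>i\<in>A. a (g i) = a (h i)} \<subseteq> (\<Union>w\<in>W. cyl w)"
  proof
    fix a assume a: "a \<in> {a \<in> space words. \<forall>i\<in>A. a (g i) = a (h i)}"
    have "g i < n" "h i < n" if "i \<in> A" for i
      using assms(3)[OF that] n[OF that] by auto
    then have "restrict a {..<n} \<in> W" using a by (auto simp: W_def space_words)
    moreover have "a \<in> cyl (restrict a {..<n})" using a by (auto simp: cyl_def)
    ultimately show "a \<in> (\<Union>w\<in>W. cyl w)" by blast
  qed
  then have "words.prob {a \<in> space words. \<forall>i\<in>A. a (g i) = a (h i)} \<le> words.prob (\<Union>w\<in>W. cyl w)"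
    using finW cyl_sets by (intro words.finite_measure_mono) auto
  also have "\<dots> \<le> (\<Sum>w\<in>W. words.prob (cyl w))"
    using finW cyl_sets by (intro words.finite_measure_subadditive_finite) auto
  also have "\<dots> = real (card W) * (1 / real (card \<Sigma>)) ^ n"
    by (simp add: prob_cyl)
  also have "\<dots> \<le> real (card \<Sigma> ^ (n - card A)) * (1 / real (card \<Sigma>)) ^ n"
    unfolding W_def using finite_alphabet assms n
    by (intro mult_right_mono of_nat_mono card_coinciding_words_le) auto
  also have "\<dots> = (1 / real (card \<Sigma>)) ^ card A"
    using card_alphabet by (subst le_add_diff_inverse[OF An, symmetric], subst power_add)
      (simp add: power_one_over)
  finally show ?thesis .
qed

text \<open>Union bound over \<open>covers \<delta> L\<close>: outside a fixed cover, at least half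
  of the \<open>L\<close> positions must coincide.\<close>

lemma prob_coverable_le:
  assumes "-1 \<le> r" "r < s"
  shows "words.prob {a \<in> space words. coverable (1 / 2) \<delta> L (mismatches a r s L)} \<le>
           (real L + 1) ^ (2 * \<delta>) * sqrt (1 / 2) ^ L"
proof -
  define E where "E C = {a \<in> space words. \<forall>i\<in>{1..L} - C. a (nat (r + int i)) = a (nat (s + int i))}" for C
  have E_sets: "E C \<in> words.events" for C
    unfolding E_def by measurable
  have prob_E: "words.prob (E C) \<le> sqrt (1 / 2) ^ L" if C: "C \<in> covers \<delta> L" for C
  proof -
    define A where "A = {1..L} - C"
    have "card A = L - card C"
      unfolding A_def using covers_subset[OF C] by (subst card_Diff_subset) (auto intro: finite_subset)
    moreover have "2 * card C \<le> L" using C by (simp add: covers_def)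
    ultimately have cardA: "L \<le> 2 * card A" by linarith
    have "words.prob (E C) \<le> (1 / real (card \<Sigma>)) ^ card A"
      unfolding E_def A_def using assms
      by (intro prob_coincidences_le) (auto intro!: inj_onI)
    also have "\<dots> \<le> (1 / 2) ^ card A"
      using card_alphabet by (intro power_mono divide_left_mono) auto
    \<comment> \<open>Base \<open>sqrt (1 / 2)\<close> expresses 2 to the power
      \<open>-L / 2\<close> without distinguishing the parity of \<open>L\<close>.\<close>
    also have "\<dots> = sqrt (1 / 2) ^ (2 * card A)"
      by (simp only: power_mult) simp
    also have "\<dots> \<le> sqrt (1 / 2) ^ L"
      using cardA by (intro power_decreasing) auto
    finally show ?thesis .
  qed
  have "{a \<in> space words. coverable (1 / 2) \<delta> L (mismatches a r s L)} \<subseteq> (\<Union>C\<in>covers \<delta> L. E C)"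
    unfolding coverable_half_iff E_def mismatches_def by blast
  then have "words.prob {a \<in> space words. coverable (1 / 2) \<delta> L (mismatches a r s L)} \<le>
      words.prob (\<Union>C\<in>covers \<delta> L. E C)"
    using E_sets finite_covers by (intro words.finite_measure_mono) auto
  also have "\<dots> \<le> (\<Sum>C\<in>covers \<delta> L. words.prob (E C))"
    using E_sets finite_covers by (intro words.finite_measure_subadditive_finite) auto
  also have "\<dots> \<le> real (card (covers \<delta> L)) * sqrt (1 / 2) ^ L"
    using prob_E by (intro sum_bounded_above) auto
  also have "\<dots> \<le> real ((L + 1) ^ (2 * \<delta>)) * sqrt (1 / 2) ^ L"
    by (intro mult_right_mono of_nat_mono card_covers_le) auto
  finally show ?thesis by (simp add: add.commute)
qed

section \<open>Almost sure failure of the condition for exponents above one\<close>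

text \<open>The squared factor will count the pairs \<open>(r, s)\<close> belonging to
  \<open>L\<close>; the remaining factor bounds the probability for one pair.\<close>

lemma summable_poly_times_geometric: "summable (\<lambda>L. (c * real L + 1) ^ 2 * ((real L + 1) ^ k * sqrt (1 / 2) ^ L))"
  if "c > 0"
proof (rule summable_comparison_test_bigo)
  show "summable (\<lambda>L. norm (inverse (real L ^ 2)))"
    using inverse_power_summable[of 2, where 'a = real] by simp
  show "(\<lambda>L. (c * real L + 1) ^ 2 * ((real L + 1) ^ k * sqrt (1 / 2) ^ L)) \<in> O(\<lambda>L. inverse (real L ^ 2))"
    using that by real_asymp
qed

lemma AE_not_condition_star:
  assumes "\<rho> > 1"
  shows "AE a in words. \<not> condition_star \<rho> a"
proof -
  \<comment> \<open>From \<open>t \<ge> \<rho> * s\<close> and \<open>L = t - s\<close> follows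
    \<open>(\<rho> - 1) * s \<le> L\<close>, that is \<open>s \<le> c * L\<close>. So
    \<open>P L\<close> below contains every pair that can occur with length
    \<open>L\<close>.\<close>
  define c where "c = 1 / (\<rho> - 1)"
  have c: "c > 0" using assms by (simp add: c_def)
  define P where "P L = {(r, s). -1 \<le> r \<and> r < s \<and> s \<le> \<lfloor>c * real L\<rfloor>}" for L :: nat
  have P_sub: "P L \<subseteq> {-1..<\<lfloor>c * real L\<rfloor>} \<times> {0..\<lfloor>c * real L\<rfloor>}" for L
    by (auto simp: P_def)
  have finP: "finite (P L)" for L
    by (rule finite_subset[OF P_sub]) auto
  have cardP: "real (card (P L)) \<le> (c * real L + 1) ^ 2" for L
  proof -
    have "real (card (P L)) \<le> real (card ({-1..<\<lfloor>c * real L\<rfloor>} \<times> {0..\<lfloor>c * real L\<rfloor>}))"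
      using P_sub by (intro of_nat_mono card_mono) auto
    \<comment> \<open>Both ranges have \<open>\<lfloor>c * real L\<rfloor> + 1\<close> elements: one
      starts at -1 and omits its upper end, the other starts at 0 and includes it.\<close>
    also have "\<dots> = (real_of_int \<lfloor>c * real L\<rfloor> + 1) ^ 2"
      using c by (simp add: power2_eq_square)
    also have "\<dots> \<le> (c * real L + 1) ^ 2"
      using c by (intro power_mono) auto
    finally show ?thesis .
  qed
  define B where "B \<delta> L = {a \<in> space words. \<exists>(r, s)\<in>P L. coverable (1 / 2) \<delta> L (mismatches a r s L)}" for \<delta> L
  have B_eq: "B \<delta> L = (\<Union>(r, s)\<in>P L. {a \<in> space words. coverable (1 / 2) \<delta> L (mismatches a r s L)})" for \<delta> L
    by (auto simp: B_def)
  have B_sets [measurable]: "B \<delta> L \<in> words.events" for \<delta> L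
    unfolding B_eq using finP by (intro sets.finite_UN) auto
  have prob_B: "words.prob (B \<delta> L) \<le> (c * real L + 1) ^ 2 * ((real L + 1) ^ (2 * \<delta>) * sqrt (1 / 2) ^ L)" for \<delta> L
  proof -
    have "words.prob (B \<delta> L) \<le>
        (\<Sum>p\<in>P L. words.prob (case p of (r, s) \<Rightarrow> {a \<in> space words. coverable (1 / 2) \<delta> L (mismatches a r s L)}))"
      unfolding B_eq using finP by (intro words.finite_measure_subadditive_finite) auto
    also have "\<dots> \<le> real (card (P L)) * ((real L + 1) ^ (2 * \<delta>) * sqrt (1 / 2) ^ L)"
      by (intro sum_bounded_above) (auto simp: P_def prob_coverable_le)
    also have "\<dots> \<le> (c * real L + 1) ^ 2 * ((real L + 1) ^ (2 * \<delta>) * sqrt (1 / 2) ^ L)"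
      using cardP by (intro mult_right_mono) auto
    finally show ?thesis .
  qed
  have "AE a in words. \<forall>\<^sub>F L in sequentially. a \<in> space words - B \<delta> L" for \<delta>
  proof (rule borel_cantelli_AE1)
    show "summable (\<lambda>L. words.prob (B \<delta> L))"
      using prob_B by (intro summable_comparison_test'[OF summable_poly_times_geometric[OF c]]) auto
  qed (auto simp: words.emeasure_eq_measure)
  then have "AE a in words. \<forall>\<delta>. \<forall>\<^sub>F L in sequentially. a \<in> space words - B \<delta> L"
    by (simp add: AE_all_countable)
  then show ?thesis
  proof (rule AE_mp, intro AE_I2 impI notI)
    fix a assume ev: "\<forall>\<delta>. \<forall>\<^sub>F L in sequentially. a \<in> space words - B \<delta> L" and "condition_star \<rho> a"
    \<comment> \<open>The choice \<open>m = 1\<close> is the tolerance 1/2.\<close>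
    from this(2)[unfolded condition_star_iff, rule_format, of 1] obtain \<delta> where
      \<delta>: "\<And>N. \<exists>r s t. -1 \<le> r \<and> r < s \<and> s < t \<and> \<rho> * real_of_int s \<le> real_of_int t \<and>
        int N \<le> s - r \<and> coverable (1 / 2) \<delta> (nat (t - s)) (mismatches a r s (nat (t - s)))"
      by auto
    from ev[rule_format, of \<delta>] obtain L0 where L0: "\<And>L. L \<ge> L0 \<Longrightarrow> a \<in> space words - B \<delta> L"
      by (auto simp: eventually_sequentially)
    \<comment> \<open>A gap of at least \<open>N\<close> with \<open>r \<ge> -1\<close> gives
      \<open>s \<ge> N - 1 \<ge> c * L0\<close>. Together with \<open>s \<le> c * L\<close> this
      forces \<open>L \<ge> L0\<close>, so long gaps produce long factors.\<close>
    obtain N :: nat where N: "real N \<ge> c * real L0 + 1" using real_arch_simple by blast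
    from \<delta>[of N] obtain r s t where
      *: "-1 \<le> r" "r < s" "s < t" "\<rho> * real_of_int s \<le> real_of_int t"
        "int N \<le> s - r" "coverable (1 / 2) \<delta> (nat (t - s)) (mismatches a r s (nat (t - s)))"
      by blast
    define L where "L = nat (t - s)"
    have L: "real L = real_of_int t - real_of_int s" using *(3) by (simp add: L_def)
    then have "(\<rho> - 1) * real_of_int s \<le> real L"
      using *(4) by (simp add: algebra_simps)
    then have sL: "real_of_int s \<le> c * real L"
      using assms by (simp add: c_def field_simps)
    have "real N - 1 \<le> real_of_int s" using *(1,5) by linarith
    then have "c * real L0 \<le> c * real L" using sL N by linarith
    then have "L0 \<le> L" using c by simp
    moreover have "(r, s) \<in> P L" using * sL by (auto simp: P_def le_floor_iff)
    ultimately show False using L0[of L] *(6) unfolding B_def L_def by blast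
  qed
qed

end

theorem theorem1p2:
  fixes \<Sigma> :: "'a set"
  assumes "finite \<Sigma>" and "card \<Sigma> \<ge> 2"
  shows "measure (bernoulli_words \<Sigma>) {a \<in> space (bernoulli_words \<Sigma>). Rdio a = 1} = 1"
proof -
  interpret uniform_alphabet \<Sigma> using assms by unfold_locales
  \<comment> \<open>Membership in the space supplies the finite alphabet that
    \<open>condition_star_1\<close> needs.\<close>
  have Rdio_iff: "Rdio a = 1 \<longleftrightarrow> (\<forall>k. \<not> condition_star (1 + 1 / real (Suc k)) a)" if "a \<in> space words" for a
    using that assms(1) by (intro Rdio_eq_1_iff condition_star_1[of \<Sigma>]) (auto simp: space_words)
  have "Measurable.pred words (\<lambda>a. \<forall>k. \<not> condition_star (1 + 1 / real (Suc k)) a)" by measurable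
  then have sets: "{a \<in> space words. Rdio a = 1} \<in> words.events"
    by (simp add: pred_def Rdio_iff cong: conj_cong)
  have "AE a in words. \<forall>k. \<not> condition_star (1 + 1 / real (Suc k)) a"
    by (subst AE_all_countable) (auto intro!: AE_not_condition_star)
  then have "AE a in words. Rdio a = 1"
    by (rule AE_mp) (auto simp: Rdio_iff)
  then show ?thesis using words.prob_Collect_eq_1[OF sets] by simp
qed

end
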